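(* Let $\mathcal{T}$ be a spherically symmetric rooted tree and let $G$ be a saturated weakly branch group on $\mathcal{T}$ which is weakly stabilizer transitive (WST). Suppose that for every automorphism $\phi$ of $G$ that is not inner there is an automorphism $t$ of the tree $\mathcal{T}$ such that $\phi(g)=tgt^{-1}$ for all $g\in G$ and $\max_i \operatorname{Orb}_i(t)<\infty$. Then $G$ is an $R_\infty$ group.
   Context: A rooted tree $\mathcal{T}$ is spherically symmetric if all vertices of the same level have the same (finite) number of immediate descendants, called the branching index of that level; branching indices are at least $2$. $L_n$ denotes the $n$-th level of $\mathcal{T}$, $\mathcal{T}_v$ the subtree with root vertex $v$ consisting of $v$ and all its descendants, and $D(v)$ the set of immediate descendants of $v$. Groups act on $\mathcal{T}$ by automorphisms (isometries) of the rooted tree, and $\operatorname{St}(v)$ denotes the stabilizer in $G$ of a vertex $v$. A group $G$ acting faithfully on $\mathcal{T}$ is a weakly branch group if for every vertex $v$ of $\mathcal{T}$ there exists an element of $G$ which acts nontrivially on $\mathcal{T}_v$ and trivially outside $\mathcal{T}_v$. $G$ is saturated if for every positive integer $n$ there exists a characteristic subgroup $H_n\subset G$ which acts trivially on $L_n$ and acts level transitively (i.e. transitively on each level) on every subtree $\mathcal{T}_v$ with $v\in L_n$. For a vertex $v\in L_j$, $G_{\{v\}}$ denotes the subgroup of all elements of $G$ fixing $v$ and fixing all vertices of the next level $L_{j+1}$ except possibly the immediate descendants of $v$; that is, $G_{\{v\}}=\bigcap_{w\in L_j,\,w\ne v}\ \bigcap_{u\in D(w)}\operatorname{St}(u)$.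 $G$ is weakly stabilizer transitive (WST) if for every vertex $v$ of $\mathcal{T}$ there is a vertex $v_0\in\mathcal{T}_v$ such that $G_{\{v_0\}}$ acts transitively on the set of immediate descendants of $v_0$. For an automorphism $t$ of $\mathcal{T}$, $\operatorname{Orb}_i(t)$ is the number of orbits of $t$ on the level $L_i$. For an automorphism $\phi:G\to G$, the Reidemeister number $R(\phi)$ is the number of equivalence classes of the relation $g\sim hg\phi(h^{-1})$, $g,h\in G$. $G$ is an $R_\infty$ group if $R(\phi)=\infty$ for every automorphism $\phi$ of $G$. *)

theory Defs
  imports "HOL-Algebra.Algebra" "HOL-Library.Extended_Nat"
begin

section \<open>Rooted trees\<close>

text \<open>A rooted tree is given by its vertices, its root, and the map sending a vertex to the set
  \<open>D v\<close> of its immediate descendants.\<close>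

record 'v rtree =
  verts :: "'v set"
  root :: 'v
  desc :: "'v \<Rightarrow> 'v set"

definition descendants :: "'v rtree \<Rightarrow> 'v \<Rightarrow> 'v set" where
  "descendants T v = {u. (v, u) \<in> {(x, y). x \<in> verts T \<and> y \<in> desc T x}\<^sup>*}"

locale rooted_tree =
  fixes T :: "'v rtree"
  assumes root_in_verts: "root T \<in> verts T"
    and desc_subset: "\<And>v. v \<in> verts T \<Longrightarrow> desc T v \<subseteq> verts T"
    and root_not_desc: "\<And>v. v \<in> verts T \<Longrightarrow> root T \<notin> desc T v"
    and unique_parent: "\<And>u v w. \<lbrakk>v \<in> verts T; w \<in> verts T; u \<in> desc T v; u \<in> desc T w\<rbrakk> \<Longrightarrow> v = w"
    and reachable: "verts T \<subseteq> descendants T (root T)"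

primrec level :: "'v rtree \<Rightarrow> nat \<Rightarrow> 'v set" where
  "level T 0 = {root T}"
| "level T (Suc n) = (\<Union>v\<in>level T n. desc T v)"

definition subtree :: "'v rtree \<Rightarrow> 'v \<Rightarrow> 'v rtree" where
  "subtree T v = \<lparr>verts = descendants T v, root = v, desc = desc T\<rparr>"

locale spherically_symmetric_tree = rooted_tree +
  assumes branching_index:
    "\<And>n. \<exists>k\<ge>2. \<forall>v\<in>level T n. finite (desc T v) \<and> card (desc T v) = k"

text \<open>As usual in \<open>HOL-Algebra\<close>, permutations of the vertex set are extensional functions.\<close>

definition tree_auto :: "'v rtree \<Rightarrow> ('v \<Rightarrow> 'v) set" where
  "tree_auto T = {t \<in> Bij (verts T). t (root T) = root T \<and> (\<forall>v\<in>verts T. t ` desc T v = desc T (t v))}"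

text \<open>Number of orbits of the cyclic group generated by \<open>t\<close> on a level.\<close>

definition Orb :: "'v rtree \<Rightarrow> ('v \<Rightarrow> 'v) \<Rightarrow> nat \<Rightarrow> nat" where
  "Orb T t i =
    card (orbits (BijGroup (verts T)\<lparr>carrier := generate (BijGroup (verts T)) {t}\<rparr>) (level T i) (\<lambda>s. s))"

section \<open>Groups acting on rooted trees\<close>

locale faithful_tree_action = faithful_action G "verts T" \<phi>
  for G :: "('g, 'm) monoid_scheme" (structure) and T :: "'v rtree" and \<phi> :: "'g \<Rightarrow> 'v \<Rightarrow> 'v" +
  assumes acts_by_tree_auto: "\<And>g. g \<in> carrier G \<Longrightarrow> \<phi> g \<in> tree_auto T"

locale weakly_branch_group = faithful_tree_action +
  assumes weakly_branch: "\<And>v. v \<in> verts T \<Longrightarrow>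
    \<exists>g\<in>carrier G. (\<exists>u\<in>verts (subtree T v). \<phi> g u \<noteq> u) \<and>
                   (\<forall>u\<in>verts T - verts (subtree T v). \<phi> g u = u)"

definition characteristic_subgroup :: "'g set \<Rightarrow> ('g, 'm) monoid_scheme \<Rightarrow> bool" where
  "characteristic_subgroup H G \<longleftrightarrow> subgroup H G \<and> (\<forall>f\<in>auto G. f ` H = H)"

definition level_transitive :: "'g set \<Rightarrow> 'v rtree \<Rightarrow> ('g \<Rightarrow> 'v \<Rightarrow> 'v) \<Rightarrow> bool" where
  "level_transitive H T \<phi> \<longleftrightarrow> (\<forall>k. \<forall>x\<in>level T k. \<forall>y\<in>level T k. \<exists>h\<in>H. \<phi> h x = y)"

definition saturated ::
    "('g, 'm) monoid_scheme \<Rightarrow> 'v rtree \<Rightarrow> ('g \<Rightarrow> 'v \<Rightarrow> 'v) \<Rightarrow> bool" where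
  "saturated G T \<phi> \<longleftrightarrow>
    (\<forall>n>0. \<exists>H. characteristic_subgroup H G \<and>
       (\<forall>h\<in>H. \<forall>v\<in>level T n. \<phi> h v = v) \<and>
       (\<forall>v\<in>level T n. level_transitive H (subtree T v) \<phi>))"

text \<open>The subgroup \<open>G\<^bsub>{v}\<^esub>\<close> for \<open>v\<close> on level \<open>j\<close>. Intersecting with the carrier
  matters only for the root, where no stabilizers are intersected and
  the subgroup is all of \<open>G\<close>.\<close>

definition vertex_subgroup ::
    "('g, 'm) monoid_scheme \<Rightarrow> 'v rtree \<Rightarrow> ('g \<Rightarrow> 'v \<Rightarrow> 'v) \<Rightarrow> nat \<Rightarrow> 'v \<Rightarrow> 'g set" where
  "vertex_subgroup G T \<phi> j v =
    carrier G \<inter> (\<Inter>w\<in>level T j - {v}. \<Inter>u\<in>desc T w. stabilizer G \<phi> u)"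

definition weakly_stabilizer_transitive ::
    "('g, 'm) monoid_scheme \<Rightarrow> 'v rtree \<Rightarrow> ('g \<Rightarrow> 'v \<Rightarrow> 'v) \<Rightarrow> bool" where
  "weakly_stabilizer_transitive G T \<phi> \<longleftrightarrow>
    (\<forall>v\<in>verts T. \<exists>v0\<in>verts (subtree T v). \<exists>j. v0 \<in> level T j \<and>
       (\<forall>x\<in>desc T v0. \<forall>y\<in>desc T v0. \<exists>g\<in>vertex_subgroup G T \<phi> j v0. \<phi> g x = y))"

section \<open>Reidemeister numbers\<close>

definition inner_auto :: "('g, 'm) monoid_scheme \<Rightarrow> ('g \<Rightarrow> 'g) \<Rightarrow> bool" where
  "inner_auto G f \<longleftrightarrow>
    (\<exists>h\<in>carrier G. \<forall>g\<in>carrier G. f g = h \<otimes>\<^bsub>G\<^esub> g \<otimes>\<^bsub>G\<^esub> inv\<^bsub>G\<^esub> h)"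

definition twisted_conj :: "('g, 'm) monoid_scheme \<Rightarrow> ('g \<Rightarrow> 'g) \<Rightarrow> ('g \<times> 'g) set" where
  "twisted_conj G f =
    {(g, k). g \<in> carrier G \<and> k \<in> carrier G \<and>
       (\<exists>h\<in>carrier G. k = h \<otimes>\<^bsub>G\<^esub> g \<otimes>\<^bsub>G\<^esub> f (inv\<^bsub>G\<^esub> h))}"

definition reidemeister_number :: "('g, 'm) monoid_scheme \<Rightarrow> ('g \<Rightarrow> 'g) \<Rightarrow> enat" where
  "reidemeister_number G f =
    (let C = carrier G // twisted_conj G f in if finite C then enat (card C) else \<infinity>)"

definition R_infinity_group :: "('g, 'm) monoid_scheme \<Rightarrow> bool" where
  "R_infinity_group G \<longleftrightarrow> group G \<and> (\<forall>f\<in>auto G. reidemeister_number G f = \<infinity>)"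

end

theory Submission
  imports Defs
begin

text \<open>Suppose that the automorphism \<open>f\<close> is conjugation by a tree automorphism \<open>t\<close>. Identify
  the elements of \<open>G\<close> with their actions. Then \<open>h g f(h\<inverse>) t = h (g t) h\<inverse>\<close>, so that
  \<open>g \<mapsto> g t\<close> turns twisted conjugacy classes of \<open>G\<close> into classes of the coset \<open>G t\<close> under
  conjugation by \<open>G\<close>. To find infinitely many of them it suffices to have a property of a tree
  automorphism on a level that is invariant under conjugation, and elements of \<open>G t\<close> for which the first
  level with this property is arbitrarily deep: the depth of that level is then an invariant of the
  class with infinitely many values (\<open>infinite_reidemeister_number_of_levels\<close>).

  If \<open>f\<close> is inner, \<open>t\<close> comes from \<open>G\<close> and the coset is \<open>G\<close> itself. The property is
  to act nontrivially on the level. A nontrivial element supported below a vertex of level \<open>n\<close>, which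
  a weakly branch group contains, is trivial on all levels up to \<open>n\<close>.

  If \<open>f\<close> is not inner, the number of orbits of \<open>t\<close> on the levels is nondecreasing and bounded,
  hence eventually equal to a constant \<open>M\<close>. The property is to have more than \<open>M\<close> orbits. By the
  weak stabilizer transitivity there are arbitrarily deep levels \<open>j\<close> with a vertex \<open>v\<close> such that
  \<open>G\<^bsub>{v}\<^esub>\<close> is transitive on the children of \<open>v\<close>. Let \<open>m\<close> be the length of the
  \<open>t\<close>-orbit of \<open>v\<close>, let \<open>x\<close> be a child of \<open>v\<close>, and choose \<open>g\<close> in
  \<open>G\<^bsub>{v}\<^esub>\<close> with \<open>g (t\<^sup>m x) = x\<close>. Up to level \<open>j\<close>, \<open>g t\<close> acts as \<open>t\<close> and
  so has at most \<open>M\<close> orbits. On level \<open>j + 1\<close> the element \<open>g\<close> intervenes only among the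
  children of \<open>v\<close>, so the \<open>g t\<close>-orbit of \<open>x\<close> closes up after \<open>m\<close> steps and misses the
  other children of \<open>v\<close>. Hence the orbit of \<open>v\<close> splits into at least two orbits, and
  there are more than \<open>M\<close> of them (\<open>Orb_jump_of_returning_child\<close>).\<close>

section \<open>Levels of a rooted tree\<close>

lemma descendants_trans:
  "v \<in> descendants T u \<Longrightarrow> w \<in> descendants T v \<Longrightarrow> w \<in> descendants T u"
  unfolding descendants_def by auto

context rooted_tree
begin

lemma level_subset_verts: "level T n \<subseteq> verts T"
  by (induction n) (use root_in_verts desc_subset in auto)

lemma level_disjoint: "v \<in> level T m \<Longrightarrow> v \<in> level T n \<Longrightarrow> m = n"
proof (induction m arbitrary: v n)
  case 0
  then show ?case
    using root_not_desc level_subset_verts by (cases n) auto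
next
  case (Suc m)
  then obtain p where p: "p \<in> level T m" "v \<in> desc T p" by auto
  with Suc.prems(2) obtain k where k: "n = Suc k"
    using root_not_desc level_subset_verts by (cases n) auto
  with Suc.prems(2) obtain q where q: "q \<in> level T k" "v \<in> desc T q" by auto
  have "p = q"
    using p q unique_parent level_subset_verts by blast
  then show ?case using Suc.IH p q k by auto
qed

lemma descendants_level:
  assumes "u \<in> descendants T v" "v \<in> level T n"
  shows "u = v \<or> (\<exists>k>n. u \<in> level T k)"
proof -
  have "(v, u) \<in> {(x, y). x \<in> verts T \<and> y \<in> desc T x}\<^sup>*"
    using assms(1) by (simp add: descendants_def)
  then show ?thesis
  proof induction
    case base
    then show ?case by simp
  next
    case (step y z)
    then obtain k where "k \<ge> n" "y \<in> level T k"
      using assms(2) by (metis less_imp_le order_refl)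
    then show ?case using step by (intro disjI2 exI[of _ "Suc k"]) auto
  qed
qed

end

context spherically_symmetric_tree
begin

lemma two_children:
  assumes "v \<in> level T n" "x \<in> desc T v"
  obtains y where "y \<in> desc T v" "y \<noteq> x"
proof -
  have "card (desc T v) \<ge> 2"
    using branching_index[of n] assms(1) by force
  then have "\<not> desc T v \<subseteq> {x}"
    using card_mono[of "{x}" "desc T v"] by auto
  then show thesis using that by blast
qed

lemma child_exists:
  assumes "v \<in> level T n"
  obtains x where "x \<in> desc T v"
proof -
  have "card (desc T v) \<ge> 2"
    using branching_index[of n] assms(1) by force
  then have "desc T v \<noteq> {}" by auto
  then show thesis using that by blast
qed

lemma level_nonempty: "level T n \<noteq> {}"
proof (induction n)
  case (Suc n)
  then obtain v where v: "v \<in> level T n" by blast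
  then obtain x where "x \<in> desc T v" using child_exists by blast
  with v show ?case by auto
qed simp

lemma finite_level: "finite (level T n)"
proof (induction n)
  case (Suc n)
  then show ?case using branching_index[of n] by auto
qed simp

end

section \<open>Tree automorphisms and their action on levels\<close>

lemma carrier_BijGroup: "carrier (BijGroup S) = Bij S"
  by (simp add: BijGroup_def)

lemma BijGroup_one_apply: "x \<in> S \<Longrightarrow> \<one>\<^bsub>BijGroup S\<^esub> x = x"
  by (simp add: BijGroup_def)

lemma BijGroup_mult_apply:
  "s \<in> Bij S \<Longrightarrow> t \<in> Bij S \<Longrightarrow> x \<in> S \<Longrightarrow> (s \<otimes>\<^bsub>BijGroup S\<^esub> t) x = s (t x)"
  by (simp add: BijGroup_def compose_def)

lemma BijGroup_nat_pow_apply: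
  assumes "s \<in> Bij S" "x \<in> S"
  shows "(s [^]\<^bsub>BijGroup S\<^esub> (n::nat)) x = (s ^^ n) x"
proof -
  interpret B: group "BijGroup S" by (rule group_BijGroup)
  have s: "s \<in> carrier (BijGroup S)" using assms(1) by (simp only: carrier_BijGroup)
  show ?thesis using assms(2)
  proof (induction n arbitrary: x)
    case 0
    then show ?case by (simp add: BijGroup_one_apply)
  next
    case (Suc n)
    have "s [^]\<^bsub>BijGroup S\<^esub> n \<in> Bij S"
      using B.nat_pow_closed[OF s, of n] by (simp only: carrier_BijGroup)
    moreover have "s x \<in> S"
      using Suc.prems assms(1) Bij_imp_funcset by fastforce
    ultimately have "(s [^]\<^bsub>BijGroup S\<^esub> Suc n) x = (s ^^ n) (s x)"
      using Suc assms(1) by (simp add: BijGroup_mult_apply)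
    then show ?case by (simp add: funpow_swap1)
  qed
qed

lemma tree_auto_Bij: "t \<in> tree_auto T \<Longrightarrow> t \<in> Bij (verts T)"
  by (simp add: tree_auto_def)

context rooted_tree
begin

lemma tree_auto_in_verts: "t \<in> tree_auto T \<Longrightarrow> v \<in> verts T \<Longrightarrow> t v \<in> verts T"
  using tree_auto_Bij Bij_imp_funcset by fastforce

lemma tree_auto_inj: "t \<in> tree_auto T \<Longrightarrow> inj_on t (verts T)"
  using tree_auto_Bij by (fastforce simp: Bij_def bij_betw_def)

lemma tree_auto_mult:
  assumes "s \<in> tree_auto T" "t \<in> tree_auto T"
  shows "s \<otimes>\<^bsub>BijGroup (verts T)\<^esub> t \<in> tree_auto T"
proof -
  note B = tree_auto_Bij[OF assms(1)] tree_auto_Bij[OF assms(2)]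
  have "s \<otimes>\<^bsub>BijGroup (verts T)\<^esub> t \<in> Bij (verts T)"
    using B by (simp add: BijGroup_def compose_Bij)
  moreover have "(s \<otimes>\<^bsub>BijGroup (verts T)\<^esub> t) ` desc T v =
      desc T ((s \<otimes>\<^bsub>BijGroup (verts T)\<^esub> t) v)" if "v \<in> verts T" for v
  proof -
    have "(s \<otimes>\<^bsub>BijGroup (verts T)\<^esub> t) ` desc T v = s ` t ` desc T v"
      unfolding image_image
    proof (rule image_cong[OF refl])
      fix u assume "u \<in> desc T v"
      then have "u \<in> verts T" using desc_subset[OF that] by blast
      then show "(s \<otimes>\<^bsub>BijGroup (verts T)\<^esub> t) u = s (t u)"
        by (rule BijGroup_mult_apply[OF B])
    qed
    then show ?thesis
      using assms that B tree_auto_in_verts by (simp add: BijGroup_mult_apply tree_auto_def)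
  qed
  ultimately show ?thesis
    using assms B root_in_verts by (simp add: tree_auto_def BijGroup_mult_apply)
qed

lemma tree_auto_level: "t \<in> tree_auto T \<Longrightarrow> t ` level T n = level T n"
proof (induction n)
  case 0
  then show ?case by (simp add: tree_auto_def)
next
  case (Suc n)
  have "t ` level T (Suc n) = (\<Union>v\<in>level T n. desc T (t v))"
    unfolding level.simps image_UN
    using Suc.prems level_subset_verts[of n] by (intro SUP_cong) (auto simp: tree_auto_def)
  also have "\<dots> = (\<Union>v\<in>t ` level T n. desc T v)" by simp
  finally show ?case using Suc by simp
qed

lemma bij_betw_level: "t \<in> tree_auto T \<Longrightarrow> bij_betw t (level T n) (level T n)"
  using tree_auto_level tree_auto_inj level_subset_verts
  by (metis bij_betw_def inj_on_subset)

lemma bij_betw_funpow_level: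
  "t \<in> tree_auto T \<Longrightarrow> bij_betw (t ^^ k) (level T n) (level T n)"
  using bij_betw_level bij_betw_funpow by blast

lemma funpow_level: "t \<in> tree_auto T \<Longrightarrow> v \<in> level T n \<Longrightarrow> (t ^^ k) v \<in> level T n"
  using bij_betw_funpow_level bij_betwE by blast

lemma tree_auto_desc:
  "t \<in> tree_auto T \<Longrightarrow> v \<in> level T n \<Longrightarrow> u \<in> desc T v \<Longrightarrow> t u \<in> desc T (t v)"
  using level_subset_verts[of n] by (fastforce simp: tree_auto_def)

lemma funpow_desc:
  "t \<in> tree_auto T \<Longrightarrow> v \<in> level T n \<Longrightarrow> u \<in> desc T v \<Longrightarrow> (t ^^ k) u \<in> desc T ((t ^^ k) v)"
  by (induction k) (auto intro: tree_auto_desc funpow_level)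

text \<open>Since \<open>s v\<close> is the parent of \<open>s u = u\<close>.\<close>

lemma fixes_parent:
  assumes "s \<in> tree_auto T" "v \<in> level T n" "u \<in> desc T v" "s u = u"
  shows "s v = v"
proof -
  have "s v \<in> level T n" using assms tree_auto_level by blast
  then show ?thesis
    using tree_auto_desc[OF assms(1-3)] assms(2-4) unique_parent level_subset_verts
    by (metis subsetD)
qed

lemma fixes_level_except_one:
  assumes "s \<in> tree_auto T" "v \<in> level T n" "\<And>w. w \<in> level T n \<Longrightarrow> w \<noteq> v \<Longrightarrow> s w = w"
  shows "\<forall>w\<in>level T n. s w = w"
proof -
  have "s v \<in> level T n" using assms tree_auto_level by blast
  then have "s v = v"
    using assms bij_betw_level[OF assms(1), of n] by (metis bij_betw_def inj_onD)
  then show ?thesis using assms(3) by blast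
qed

end

context spherically_symmetric_tree
begin

lemma fixes_lower_levels:
  assumes "s \<in> tree_auto T" "\<forall>w\<in>level T n. s w = w" "i \<le> n"
  shows "\<forall>w\<in>level T i. s w = w"
  using assms(3)
proof (induction rule: inc_induct)
  case base
  then show ?case using assms(2) .
next
  case (step k)
  show ?case
  proof
    fix w assume w: "w \<in> level T k"
    then obtain u where u: "u \<in> desc T w" using child_exists by blast
    with w have "u \<in> level T (Suc k)" by auto
    then show "s w = w" using step.IH fixes_parent[OF assms(1) w u] by blast
  qed
qed

end

section \<open>Counting orbits\<close>

text \<open>On a finite level every orbit of a tree automorphism is a cycle, so that nonnegative powers
  already exhaust it. Iterates are easier to follow from parent to child than elements of the cyclic
  group generated by the automorphism.\<close>

definition forward_orbit :: "('v \<Rightarrow> 'v) \<Rightarrow> 'v \<Rightarrow> 'v set" where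
  "forward_orbit s x = range (\<lambda>n. (s ^^ n) x)"

lemma forward_orbit_self: "x \<in> forward_orbit s x"
  unfolding forward_orbit_def by (rule range_eqI[of _ _ 0]) simp

lemma forward_orbit_trans:
  "y \<in> forward_orbit s x \<Longrightarrow> z \<in> forward_orbit s y \<Longrightarrow> z \<in> forward_orbit s x"
  unfolding forward_orbit_def by (auto simp: funpow_add[symmetric, THEN fun_cong, simplified o_def])

context spherically_symmetric_tree
begin

lemma exists_period:
  assumes "t \<in> tree_auto T" "x \<in> level T n"
  obtains m where "m > 0" "(t ^^ m) x = x" "\<And>k. 0 < k \<Longrightarrow> k < m \<Longrightarrow> (t ^^ k) x \<noteq> x"
proof -
  have "finite (range (\<lambda>k. (t ^^ k) x))"
    by (rule finite_subset[OF _ finite_level[of n]]) (use assms funpow_level in auto)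
  then have "\<not> inj (\<lambda>k. (t ^^ k) x)"
    using finite_imageD infinite_UNIV_nat by blast
  then obtain c d where "c \<noteq> d" "(t ^^ c) x = (t ^^ d) x"
    by (auto simp: inj_on_def)
  then obtain a b where ab: "a < b" "(t ^^ a) x = (t ^^ b) x"
    by (cases c d rule: linorder_cases) auto
  have "(t ^^ b) x = (t ^^ a) ((t ^^ (b - a)) x)"
    using ab(1) funpow_add[of a "b - a" t] by simp
  then have "(t ^^ a) ((t ^^ (b - a)) x) = (t ^^ a) x"
    using ab(2) by simp
  then have "(t ^^ (b - a)) x = x"
    using bij_betw_imp_inj_on[OF bij_betw_funpow_level[OF assms(1)]] funpow_level[OF assms] assms(2)
    by (blast dest: inj_onD)
  then have ex: "\<exists>m. 0 < m \<and> (t ^^ m) x = x" using ab(1) by (intro exI[of _ "b - a"]) auto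
  define m where "m = (LEAST m. 0 < m \<and> (t ^^ m) x = x)"
  have "0 < m \<and> (t ^^ m) x = x" unfolding m_def using ex by (rule LeastI_ex)
  moreover have "(t ^^ k) x \<noteq> x" if "0 < k" "k < m" for k
    using that not_less_Least unfolding m_def by blast
  ultimately show thesis using that by blast
qed

lemma orbit_generate_eq_forward_orbit:
  assumes t: "t \<in> tree_auto T" and x: "x \<in> level T n"
  shows "orbit (BijGroup (verts T)\<lparr>carrier := generate (BijGroup (verts T)) {t}\<rparr>) (\<lambda>s. s) x =
    forward_orbit t x"
proof -
  let ?B = "BijGroup (verts T)"
  interpret B: group ?B by (rule group_BijGroup)
  have tB: "t \<in> carrier ?B" using tree_auto_Bij[OF t] by (simp only: carrier_BijGroup)
  have sub: "s \<in> Bij (verts T)" if "s \<in> generate ?B {t}" for s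
    using B.generate_in_carrier[of "{t}" s] that tB by (simp add: carrier_BijGroup)
  have gen: "s y \<in> forward_orbit t y" if "s \<in> generate ?B {t}" "y \<in> level T n" for s y
    using that
  proof (induction arbitrary: y)
    case one
    then show ?case
      using forward_orbit_self level_subset_verts by (metis BijGroup_one_apply subsetD)
  next
    case (incl h)
    then show ?case unfolding forward_orbit_def by (intro range_eqI[of _ _ 1]) simp
  next
    case (inv h)
    then have h: "h = t" by simp
    obtain m where m: "m > 0" "(t ^^ m) y = y" using exists_period[OF t inv.prems] by blast
    \<comment> \<open>The inverse of \<open>t\<close> moves \<open>y\<close> one step back, to the last vertex of its cycle.\<close>
    let ?z = "(t ^^ (m - 1)) y"
    have z: "?z \<in> level T n" using funpow_level t inv.prems by blast
    then have zV: "?z \<in> verts T" using level_subset_verts by blast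
    have tz: "t ?z = y" using m by (cases m) auto
    have iB: "inv\<^bsub>?B\<^esub> t \<in> Bij (verts T)"
      using B.inv_closed[OF tB] by (simp only: carrier_BijGroup)
    have "(inv\<^bsub>?B\<^esub> t) y = (inv\<^bsub>?B\<^esub> t \<otimes>\<^bsub>?B\<^esub> t) ?z"
      using BijGroup_mult_apply[OF iB tree_auto_Bij[OF t] zV] tz by simp
    also have "\<dots> = ?z" using zV B.l_inv[OF tB] by (simp add: BijGroup_one_apply)
    finally show ?case unfolding h forward_orbit_def by blast
  next
    case (eng h1 h2)
    have "h2 y \<in> forward_orbit t y" using eng by blast
    moreover from this have "h2 y \<in> level T n"
      using eng.prems funpow_level t unfolding forward_orbit_def by auto
    ultimately have "h1 (h2 y) \<in> forward_orbit t y"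
      using eng.IH(1) forward_orbit_trans by metis
    then show ?case
      using eng sub level_subset_verts by (metis BijGroup_mult_apply subsetD)
  qed
  have pow: "t [^]\<^bsub>?B\<^esub> k \<in> generate ?B {t}" for k :: nat
    by (induction k) (auto intro: generate.intros)
  have xV: "x \<in> verts T" using x level_subset_verts by blast
  show ?thesis
  proof
    show "orbit (?B\<lparr>carrier := generate ?B {t}\<rparr>) (\<lambda>s. s) x \<subseteq> forward_orbit t x"
      using gen x by (auto simp: orbit_def)
    show "forward_orbit t x \<subseteq> orbit (?B\<lparr>carrier := generate ?B {t}\<rparr>) (\<lambda>s. s) x"
    proof
      fix y assume "y \<in> forward_orbit t x"
      then obtain k where "y = (t ^^ k) x" by (auto simp: forward_orbit_def)
      then have "y = (t [^]\<^bsub>?B\<^esub> k) x"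
        using BijGroup_nat_pow_apply[OF tree_auto_Bij[OF t] xV] by simp
      then show "y \<in> orbit (?B\<lparr>carrier := generate ?B {t}\<rparr>) (\<lambda>s. s) x"
        using pow unfolding orbit_def by auto
    qed
  qed
qed

lemma Orb_eq:
  assumes "t \<in> tree_auto T"
  shows "Orb T t n = card (forward_orbit t ` level T n)"
proof -
  have "orbits (BijGroup (verts T)\<lparr>carrier := generate (BijGroup (verts T)) {t}\<rparr>) (level T n) (\<lambda>s. s)
      = forward_orbit t ` level T n"
    using orbit_generate_eq_forward_orbit[OF assms] by (auto simp: orbits_def)
  then show ?thesis by (simp add: Orb_def)
qed

lemma Orb_cong:
  assumes "s \<in> tree_auto T" "t \<in> tree_auto T" "\<And>v. v \<in> level T n \<Longrightarrow> s v = t v"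
  shows "Orb T s n = Orb T t n"
proof -
  have "(s ^^ k) v = (t ^^ k) v" if "v \<in> level T n" for k v
    by (induction k) (use that assms funpow_level in auto)
  then have "forward_orbit s ` level T n = forward_orbit t ` level T n"
    by (auto simp: forward_orbit_def intro!: image_cong)
  then show ?thesis using assms by (simp add: Orb_eq)
qed

text \<open>The conjugating automorphism \<open>h\<close> carries the orbits of \<open>s\<close> bijectively to those of
  \<open>s'\<close>. The relation \<open>s' h = h s\<close> is used instead of \<open>s' = h s h\<inverse>\<close> so that no inverse
  has to be evaluated.\<close>

lemma Orb_conjugate:
  assumes h: "h \<in> tree_auto T" and s: "s \<in> tree_auto T" and s': "s' \<in> tree_auto T"
    and "\<And>v. v \<in> verts T \<Longrightarrow> s' (h v) = h (s v)"
  shows "Orb T s' n = Orb T s n"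
proof -
  have pow: "(s' ^^ k) (h v) = h ((s ^^ k) v)" if "v \<in> level T n" for k v
    by (induction k) (use that assms funpow_level level_subset_verts[of n] in \<open>auto simp: subset_iff\<close>)
  have "forward_orbit s' ` level T n = forward_orbit s' ` h ` level T n"
    using tree_auto_level[OF h] by simp
  also have "\<dots> = (`) h ` forward_orbit s ` level T n"
    using pow by (auto simp: forward_orbit_def image_image intro!: image_cong)
  finally have eq: "forward_orbit s' ` level T n = (`) h ` forward_orbit s ` level T n" .
  have "\<Union> (forward_orbit s ` level T n) \<subseteq> verts T"
    using funpow_level s level_subset_verts by (fastforce simp: forward_orbit_def)
  then have "inj_on ((`) h) (forward_orbit s ` level T n)"
    using tree_auto_inj[OF h] by (intro inj_on_image) (metis inj_on_subset)
  then show ?thesis using eq s s' by (simp add: Orb_eq card_image)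
qed

text \<open>Taking parents maps the orbits on level \<open>n + 1\<close> onto those on level \<open>n\<close>. The two numbers
  agree only if this map is injective, which fails as soon as two children of the same vertex lie in
  different orbits.\<close>

lemma Orb_Suc:
  assumes s: "s \<in> tree_auto T"
  shows "Orb T s n \<le> Orb T s (Suc n)"
    and "v \<in> level T n \<Longrightarrow> x \<in> desc T v \<Longrightarrow> y \<in> desc T v \<Longrightarrow> y \<notin> forward_orbit s x \<Longrightarrow>
      Orb T s n < Orb T s (Suc n)"
proof -
  define parent where "parent u = (THE v. v \<in> level T n \<and> u \<in> desc T v)" for u
  have parent_eq: "parent u = v" if "v \<in> level T n" "u \<in> desc T v" for u v
    unfolding parent_def using that unique_parent level_subset_verts
    by (intro the_equality) blast+
  have orbit_parent: "parent ` forward_orbit s u = forward_orbit s v"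
    if "v \<in> level T n" "u \<in> desc T v" for u v
    using parent_eq funpow_level[OF s] funpow_desc[OF s] that
    by (auto simp: forward_orbit_def image_image intro!: image_cong)
  let ?O = "forward_orbit s ` level T (Suc n)"
  have fin: "finite ?O" using finite_level by blast
  have onto: "(`) parent ` ?O = forward_orbit s ` level T n"
  proof
    show "(`) parent ` ?O \<subseteq> forward_orbit s ` level T n"
      using orbit_parent by auto
    show "forward_orbit s ` level T n \<subseteq> (`) parent ` ?O"
    proof
      fix A assume "A \<in> forward_orbit s ` level T n"
      then obtain v where v: "v \<in> level T n" "A = forward_orbit s v" by blast
      obtain u where u: "u \<in> desc T v" using child_exists v by blast
      then have "u \<in> level T (Suc n)" using v by auto
      moreover have "A = parent ` forward_orbit s u" using orbit_parent u v by simp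
      ultimately show "A \<in> (`) parent ` ?O" by blast
    qed
  qed
  show le: "Orb T s n \<le> Orb T s (Suc n)"
    using card_image_le[OF fin, of "(`) parent"] onto s by (simp add: Orb_eq)
  assume v: "v \<in> level T n" and xy: "x \<in> desc T v" "y \<in> desc T v" "y \<notin> forward_orbit s x"
  have "\<not> inj_on ((`) parent) ?O"
  proof
    assume inj: "inj_on ((`) parent) ?O"
    have "x \<in> level T (Suc n)" "y \<in> level T (Suc n)" using v xy by auto
    then have O: "forward_orbit s x \<in> ?O" "forward_orbit s y \<in> ?O" by (blast intro: imageI)+
    have "parent ` forward_orbit s x = parent ` forward_orbit s y"
      using orbit_parent[OF v xy(1)] orbit_parent[OF v xy(2)] by (simp only:)
    from inj_onD[OF inj this O] have "forward_orbit s x = forward_orbit s y" .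
    then show False using xy(3) forward_orbit_self[of y s] by simp
  qed
  then have "Orb T s n \<noteq> Orb T s (Suc n)"
    using eq_card_imp_inj_on[OF fin, of "(`) parent"] onto s by (metis Orb_eq)
  then show "Orb T s n < Orb T s (Suc n)" using le by simp
qed

lemma Orb_eventually_constant:
  assumes "t \<in> tree_auto T" "bdd_above (range (Orb T t))"
  obtains N where "\<And>i. i \<ge> N \<Longrightarrow> Orb T t i = Orb T t N"
proof -
  have mono: "mono (Orb T t)" using Orb_Suc(1)[OF assms(1)] by (simp add: mono_iff_le_Suc)
  have "finite (range (Orb T t))" using assms(2) by (simp add: bdd_above_nat)
  then have "Max (range (Orb T t)) \<in> range (Orb T t)" by (intro Max_in) auto
  then obtain N where "Orb T t N = Max (range (Orb T t))" by (metis imageE)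
  then have "Orb T t i \<le> Orb T t N" for i using \<open>finite (range (Orb T t))\<close> by simp
  then show thesis using that mono by (metis le_antisym monoD)
qed

text \<open>Here \<open>a\<close> corrects \<open>t\<close> only among the children of \<open>v\<close>. As the \<open>t\<close>-orbit of
  \<open>v\<close> avoids \<open>v\<close> at the times strictly between \<open>0\<close> and \<open>m\<close>, the iterates of \<open>x\<close>
  under \<open>a t\<close> coincide with those under \<open>t\<close> until time \<open>m\<close>, when \<open>a\<close> sends the vertex
  back to \<open>x\<close>. The resulting cycle meets the children of \<open>v\<close> in \<open>x\<close> alone.\<close>

lemma Orb_jump_of_returning_child:
  assumes t: "t \<in> tree_auto T" and a: "a \<in> tree_auto T"
    and v: "v \<in> level T j" and x: "x \<in> desc T v"
    and fixes_others: "\<And>w u. w \<in> level T j \<Longrightarrow> w \<noteq> v \<Longrightarrow> u \<in> desc T w \<Longrightarrow> a u = u"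
    and m: "m > 0" "(t ^^ m) v = v" "\<And>k. 0 < k \<Longrightarrow> k < m \<Longrightarrow> (t ^^ k) v \<noteq> v"
    and returns: "a ((t ^^ m) x) = x"
  shows "Orb T (a \<otimes>\<^bsub>BijGroup (verts T)\<^esub> t) j < Orb T (a \<otimes>\<^bsub>BijGroup (verts T)\<^esub> t) (Suc j)"
proof -
  let ?s = "a \<otimes>\<^bsub>BijGroup (verts T)\<^esub> t"
  have s: "?s \<in> tree_auto T" by (rule tree_auto_mult[OF a t])
  have step: "?s ((t ^^ k) x) = a ((t ^^ Suc k) x)" for k
  proof -
    have "x \<in> level T (Suc j)" using v x by auto
    then have "(t ^^ k) x \<in> level T (Suc j)" by (rule funpow_level[OF t])
    then show ?thesis
      using tree_auto_Bij[OF a] tree_auto_Bij[OF t] level_subset_verts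
      by (simp add: BijGroup_mult_apply subset_iff del: level.simps)
  qed
  have early: "(?s ^^ k) x = (t ^^ k) x" if "k < m" for k
    using that
  proof (induction k)
    case (Suc k)
    have "a ((t ^^ Suc k) x) = (t ^^ Suc k) x"
      using Suc.prems by (intro fixes_others[OF funpow_level[OF t v] m(3) funpow_desc[OF t v x]]) auto
    then show ?case using Suc step by simp
  qed simp
  obtain l where l: "m = Suc l" using m(1) by (cases m) auto
  have period: "(?s ^^ m) x = x" using early[of l] step[of l] returns l by simp
  then have orbit: "\<exists>k<m. z = (t ^^ k) x" if "z \<in> forward_orbit ?s x" for z
  proof -
    obtain n where "z = (?s ^^ n) x" using \<open>z \<in> forward_orbit ?s x\<close> by (auto simp: forward_orbit_def)
    then have "z = (?s ^^ (n mod m)) x" using funpow_mod_eq[OF period] by simp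
    then show ?thesis using early[of "n mod m"] m(1) by (intro exI[of _ "n mod m"]) simp
  qed
  obtain y where y: "y \<in> desc T v" "y \<noteq> x" using two_children v x by blast
  have "y \<notin> forward_orbit ?s x"
  proof
    assume "y \<in> forward_orbit ?s x"
    then obtain k where k: "k < m" "y = (t ^^ k) x" using orbit by blast
    then have "k > 0" using y by (cases k) auto
    moreover have "(t ^^ k) v = v"
      using funpow_desc[OF t v x, of k] k(2) y(1)
        subsetD[OF level_subset_verts funpow_level[OF t v, of k]] subsetD[OF level_subset_verts v]
      by (intro unique_parent) simp_all
    ultimately show False using m(3) k by blast
  qed
  then show ?thesis using Orb_Suc(2)[OF s v x y(1)] by blast
qed

end

section \<open>Twisted conjugacy classes and invariants\<close>

lemma infinite_reidemeister_number:
  assumes "group G" "f \<in> auto G"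
    and inv: "\<And>g h. g \<in> carrier G \<Longrightarrow> h \<in> carrier G \<Longrightarrow>
      F (h \<otimes>\<^bsub>G\<^esub> g \<otimes>\<^bsub>G\<^esub> f (inv\<^bsub>G\<^esub> h)) = F g"
    and inf: "infinite (F ` carrier G)"
  shows "reidemeister_number G f = \<infinity>"
proof -
  interpret G: group G by fact
  interpret f: group_hom G G f
    using assms(2) by (unfold_locales) (simp add: auto_def)
  let ?r = "twisted_conj G f"
  have "F ` carrier G \<subseteq> (\<lambda>C. F (SOME y. y \<in> C)) ` (carrier G // ?r)"
  proof
    fix z assume "z \<in> F ` carrier G"
    then obtain g where g: "g \<in> carrier G" "z = F g" by blast
    have "\<exists>h\<in>carrier G. g = h \<otimes>\<^bsub>G\<^esub> g \<otimes>\<^bsub>G\<^esub> f (inv\<^bsub>G\<^esub> h)"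
      using g by (intro bexI[of _ "\<one>\<^bsub>G\<^esub>"]) simp_all
    then have "g \<in> ?r `` {g}" using g by (auto simp: twisted_conj_def)
    then have "(SOME y. y \<in> ?r `` {g}) \<in> ?r `` {g}" by (rule someI)
    then have "F (SOME y. y \<in> ?r `` {g}) = z"
      using inv g by (auto simp: twisted_conj_def)
    then show "z \<in> (\<lambda>C. F (SOME y. y \<in> C)) ` (carrier G // ?r)"
      using g by (auto simp: quotient_def intro!: image_eqI[of _ _ "?r `` {g}"])
  qed
  then have "infinite (carrier G // ?r)" using inf finite_subset by blast
  then show ?thesis by (simp add: reidemeister_number_def Let_def)
qed

text \<open>Multiplying by \<open>t\<close> on the right turns twisted conjugacy into conjugacy, so the first level
  where \<open>g t\<close> satisfies a conjugation invariant property depends only on the twisted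
  conjugacy class of \<open>g\<close>. It takes infinitely many values if it can be made arbitrarily large.\<close>

lemma (in faithful_tree_action) infinite_reidemeister_number_of_levels:
  fixes P :: "nat \<Rightarrow> _ \<Rightarrow> bool"
  assumes tree: "rooted_tree T" and f: "f \<in> auto G" and t: "t \<in> tree_auto T"
    and ft: "\<And>g. g \<in> carrier G \<Longrightarrow> \<phi> (f g) =
       t \<otimes>\<^bsub>BijGroup (verts T)\<^esub> \<phi> g \<otimes>\<^bsub>BijGroup (verts T)\<^esub> inv\<^bsub>BijGroup (verts T)\<^esub> t"
    and conj: "\<And>i h s s'. h \<in> tree_auto T \<Longrightarrow> s \<in> tree_auto T \<Longrightarrow> s' \<in> tree_auto T \<Longrightarrow>
       (\<And>v. v \<in> verts T \<Longrightarrow> s' (h v) = h (s v)) \<Longrightarrow> P i s' = P i s"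
    and deep: "\<And>n. \<exists>g\<in>carrier G. (\<forall>i\<le>n. \<not> P i (\<phi> g \<otimes>\<^bsub>BijGroup (verts T)\<^esub> t)) \<and>
       (\<exists>i. P i (\<phi> g \<otimes>\<^bsub>BijGroup (verts T)\<^esub> t))"
  shows "reidemeister_number G f = \<infinity>"
proof -
  let ?B = "BijGroup (verts T)"
  interpret T: rooted_tree T by fact
  interpret hom: group_hom G ?B \<phi> by (rule group_hom)
  interpret f: group_hom G G f
    using f by (unfold_locales) (simp add: auto_def)
  have tB: "t \<in> carrier ?B" using tree_auto_Bij[OF t] by (simp only: carrier_BijGroup)
  define F where "F g = (LEAST i. P i (\<phi> g \<otimes>\<^bsub>?B\<^esub> t))" for g
  have "F (h \<otimes> g \<otimes> f (inv h)) = F g" if gh: "g \<in> carrier G" "h \<in> carrier G" for g h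
  proof -
    let ?s = "\<phi> g \<otimes>\<^bsub>?B\<^esub> t" and ?s' = "\<phi> (h \<otimes> g \<otimes> f (inv h)) \<otimes>\<^bsub>?B\<^esub> t"
    have s: "?s \<in> tree_auto T" "?s' \<in> tree_auto T" "\<phi> h \<in> tree_auto T"
      using gh by (simp_all add: T.tree_auto_mult[OF acts_by_tree_auto t] acts_by_tree_auto
          del: f.hom_inv hom.hom_mult)
    have "?s' \<otimes>\<^bsub>?B\<^esub> \<phi> h = \<phi> h \<otimes>\<^bsub>?B\<^esub> \<phi> g \<otimes>\<^bsub>?B\<^esub>
        (t \<otimes>\<^bsub>?B\<^esub> inv\<^bsub>?B\<^esub> \<phi> h \<otimes>\<^bsub>?B\<^esub> inv\<^bsub>?B\<^esub> t) \<otimes>\<^bsub>?B\<^esub> t \<otimes>\<^bsub>?B\<^esub> \<phi> h"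
      using gh ft[of "inv h"] by simp
    also have "\<dots> = \<phi> h \<otimes>\<^bsub>?B\<^esub> ?s"
      using gh tB by (simp add: hom.H.m_assoc hom.H.inv_solve_left')
    finally have "?s' (\<phi> h v) = \<phi> h (?s v)" if "v \<in> verts T" for v
      using s that by (metis BijGroup_mult_apply tree_auto_Bij)
    then have "P i ?s' = P i ?s" for i using conj s by blast
    then show ?thesis unfolding F_def by simp
  qed
  moreover have "\<exists>k>n. k \<in> F ` carrier G" for n
  proof -
    obtain g where g: "g \<in> carrier G" "\<forall>i\<le>n. \<not> P i (\<phi> g \<otimes>\<^bsub>?B\<^esub> t)"
      "\<exists>i. P i (\<phi> g \<otimes>\<^bsub>?B\<^esub> t)" using deep[of n] by blast
    from g(3) have first: "P (F g) (\<phi> g \<otimes>\<^bsub>?B\<^esub> t)" 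
      unfolding F_def by (rule LeastI_ex[where P = "\<lambda>i. P i (\<phi> g \<otimes>\<^bsub>?B\<^esub> t)"])
    have "F g > n"
    proof (rule ccontr)
      assume "\<not> F g > n"
      then have "F g \<le> n" by simp
      then have "\<not> P (F g) (\<phi> g \<otimes>\<^bsub>?B\<^esub> t)" by (rule g(2)[rule_format])
      then show False using first by (rule notE)
    qed
    then show ?thesis using g(1) by (intro exI[of _ "F g"] conjI imageI)
  qed
  then have "infinite (F ` carrier G)" by (simp add: infinite_nat_iff_unbounded)
  ultimately show ?thesis
    using infinite_reidemeister_number[OF _ f] hom.G.is_group by blast
qed

section \<open>Inner automorphisms and tree automorphisms with bounded orbit numbers\<close>

text \<open>An element supported below a vertex \<open>v\<close> of level \<open>n\<close> fixes all other vertices of that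
  level, hence \<open>v\<close> as well, and then all ancestors of these vertices.\<close>

lemma (in weakly_branch_group) deep_nontrivial_element:
  assumes "spherically_symmetric_tree T"
  obtains g where "g \<in> carrier G" "\<And>i v. i \<le> n \<Longrightarrow> v \<in> level T i \<Longrightarrow> \<phi> g v = v"
    "\<exists>i. \<exists>v\<in>level T i. \<phi> g v \<noteq> v"
proof -
  interpret T: spherically_symmetric_tree T by fact
  obtain v where v: "v \<in> level T n" using T.level_nonempty by blast
  then obtain g where g: "g \<in> carrier G" "\<exists>u\<in>descendants T v. \<phi> g u \<noteq> u"
      "\<forall>u\<in>verts T - descendants T v. \<phi> g u = u"
    using weakly_branch[of v] T.level_subset_verts by (auto simp: subtree_def)
  have a: "\<phi> g \<in> tree_auto T" using g acts_by_tree_auto by blast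
  have "\<phi> g w = w" if w: "w \<in> level T n" "w \<noteq> v" for w
  proof -
    have "w \<notin> descendants T v"
      using T.descendants_level[OF _ v] w T.level_disjoint by blast
    then show ?thesis using g(3) w T.level_subset_verts by blast
  qed
  then have "\<forall>w\<in>level T n. \<phi> g w = w" by (rule T.fixes_level_except_one[OF a v])
  then have "\<phi> g w = w" if "i \<le> n" "w \<in> level T i" for i w
    using T.fixes_lower_levels[OF a] that by blast
  moreover have "\<exists>i. \<exists>u\<in>level T i. \<phi> g u \<noteq> u"
    using g(2) T.descendants_level[OF _ v] v by blast
  ultimately show thesis using that g(1) by blast
qed

text \<open>The first level on which an automorphism acts nontrivially is invariant under conjugation.
  If \<open>f\<close> is conjugation by \<open>h\<close>, every \<open>k\<close> in \<open>G\<close> has the form \<open>g h\<close> with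
  \<open>g = k h\<inverse>\<close>, so it suffices to have nontrivial elements of \<open>G\<close> that are trivial on many levels.\<close>

lemma (in weakly_branch_group) reidemeister_inner:
  assumes tree: "spherically_symmetric_tree T" and f: "f \<in> auto G" and "inner_auto G f"
  shows "reidemeister_number G f = \<infinity>"
proof -
  let ?B = "BijGroup (verts T)"
  interpret T: spherically_symmetric_tree T by fact
  interpret hom: group_hom G ?B \<phi> by (rule group_hom)
  obtain h where h: "h \<in> carrier G" "\<And>g. g \<in> carrier G \<Longrightarrow> f g = h \<otimes> g \<otimes> inv h"
    using assms(3) by (auto simp: inner_auto_def)
  define P where "P i s = (\<exists>v\<in>level T i. s v \<noteq> v)" for i s
  show ?thesis
  proof (rule infinite_reidemeister_number_of_levels[where t = "\<phi> h" and P = P])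
    show "rooted_tree T" by unfold_locales
    show "f \<in> auto G" "\<phi> h \<in> tree_auto T" using f h acts_by_tree_auto by auto
    show "\<phi> (f g) = \<phi> h \<otimes>\<^bsub>?B\<^esub> \<phi> g \<otimes>\<^bsub>?B\<^esub> inv\<^bsub>?B\<^esub> \<phi> h" if "g \<in> carrier G" for g
      using h that by simp
  next
    fix i a s s'
    assume a: "a \<in> tree_auto T" and s: "s \<in> tree_auto T" and "s' \<in> tree_auto T"
      and eq: "\<And>v. v \<in> verts T \<Longrightarrow> s' (a v) = a (s v)"
    have "(s' (a v) = a v) = (s v = v)" if "v \<in> level T i" for v
    proof -
      have "v \<in> verts T" using that T.level_subset_verts by blast
      then show ?thesis
        using eq T.tree_auto_in_verts[OF s] T.tree_auto_inj[OF a] by (metis inj_onD)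
    qed
    then have "P i s \<longleftrightarrow> (\<exists>w\<in>a ` level T i. s' w \<noteq> w)" unfolding P_def by blast
    then show "P i s' = P i s" using T.tree_auto_level[OF a] unfolding P_def by simp
  next
    fix n
    obtain k where k: "k \<in> carrier G" "\<And>i v. i \<le> n \<Longrightarrow> v \<in> level T i \<Longrightarrow> \<phi> k v = v"
      "\<exists>i. \<exists>v\<in>level T i. \<phi> k v \<noteq> v"
      using deep_nontrivial_element[OF tree] by metis
    have "\<phi> (k \<otimes> inv h) \<otimes>\<^bsub>?B\<^esub> \<phi> h = \<phi> k"
      using k(1) h(1) by (simp add: hom.H.m_assoc)
    then show "\<exists>g\<in>carrier G. (\<forall>i\<le>n. \<not> P i (\<phi> g \<otimes>\<^bsub>?B\<^esub> \<phi> h)) \<and> (\<exists>i. P i (\<phi> g \<otimes>\<^bsub>?B\<^esub> \<phi> h))"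
      using k h(1) unfolding P_def by (intro bexI[of _ "k \<otimes> inv h"]) auto
  qed
qed

lemma (in faithful_tree_action) deep_transitive_vertex:
  assumes "spherically_symmetric_tree T" "weakly_stabilizer_transitive G T \<phi>"
  obtains j v where "j \<ge> n" "v \<in> level T j"
    "\<And>x y. x \<in> desc T v \<Longrightarrow> y \<in> desc T v \<Longrightarrow> \<exists>g\<in>vertex_subgroup G T \<phi> j v. \<phi> g x = y"
proof -
  interpret T: spherically_symmetric_tree T by fact
  obtain w where w: "w \<in> level T n" using T.level_nonempty by blast
  then have "w \<in> verts T" using T.level_subset_verts by blast
  then obtain v j where v: "v \<in> descendants T w" "v \<in> level T j"
      "\<forall>x\<in>desc T v. \<forall>y\<in>desc T v. \<exists>g\<in>vertex_subgroup G T \<phi> j v. \<phi> g x = y"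
    using assms(2) unfolding weakly_stabilizer_transitive_def subtree_def by fastforce
  have "j \<ge> n"
    using T.descendants_level[OF v(1) w] w v(2) T.level_disjoint by (metis less_imp_le order_refl)
  then show thesis using that v by blast
qed

text \<open>The first level with more orbits than \<open>t\<close> has on any level is invariant under
  conjugation. It is moved arbitrarily far down by correcting \<open>t\<close> only among the children of a
  deep vertex.\<close>

lemma (in faithful_tree_action) reidemeister_bounded_orbits:
  assumes tree: "spherically_symmetric_tree T" and wst: "weakly_stabilizer_transitive G T \<phi>"
    and f: "f \<in> auto G" and t: "t \<in> tree_auto T"
    and ft: "\<And>g. g \<in> carrier G \<Longrightarrow> \<phi> (f g) =
       t \<otimes>\<^bsub>BijGroup (verts T)\<^esub> \<phi> g \<otimes>\<^bsub>BijGroup (verts T)\<^esub> inv\<^bsub>BijGroup (verts T)\<^esub> t"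
    and bdd: "bdd_above (range (Orb T t))"
  shows "reidemeister_number G f = \<infinity>"
proof -
  let ?B = "BijGroup (verts T)"
  interpret T: spherically_symmetric_tree T by fact
  obtain N where N: "\<And>i. i \<ge> N \<Longrightarrow> Orb T t i = Orb T t N"
    using T.Orb_eventually_constant[OF t bdd] by blast
  have mono: "mono (Orb T t)" using T.Orb_Suc(1)[OF t] by (simp add: mono_iff_le_Suc)
  have le_N: "Orb T t i \<le> Orb T t N" for i
    using N monoD[OF mono] by (metis linorder_linear)
  define P where "P i s = (Orb T s i > Orb T t N)" for i s
  show ?thesis
  proof (rule infinite_reidemeister_number_of_levels[OF _ f t ft, where P = P])
    show "rooted_tree T" by unfold_locales
    show "P i s' = P i s"
      if "h \<in> tree_auto T" "s \<in> tree_auto T" "s' \<in> tree_auto T"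
        "\<And>v. v \<in> verts T \<Longrightarrow> s' (h v) = h (s v)" for i h s s'
      using T.Orb_conjugate[OF that] unfolding P_def by simp
  next
    fix n
    obtain j v where j: "j \<ge> max n N" and v: "v \<in> level T j"
      and trans: "\<And>x y. x \<in> desc T v \<Longrightarrow> y \<in> desc T v \<Longrightarrow>
        \<exists>g\<in>vertex_subgroup G T \<phi> j v. \<phi> g x = y"
      using deep_transitive_vertex[OF tree wst] by metis
    obtain m where m: "m > 0" "(t ^^ m) v = v" "\<And>k. 0 < k \<Longrightarrow> k < m \<Longrightarrow> (t ^^ k) v \<noteq> v"
      using T.exists_period[OF t v] by blast
    obtain x where x: "x \<in> desc T v" using T.child_exists[OF v] by blast
    have "(t ^^ m) x \<in> desc T v" using T.funpow_desc[OF t v x, of m] m by simp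
    then obtain g where g: "g \<in> vertex_subgroup G T \<phi> j v" "\<phi> g ((t ^^ m) x) = x"
      using trans x by blast
    then have gG: "g \<in> carrier G" by (simp add: vertex_subgroup_def)
    then have a: "\<phi> g \<in> tree_auto T" by (rule acts_by_tree_auto)
    let ?s = "\<phi> g \<otimes>\<^bsub>?B\<^esub> t"
    have s: "?s \<in> tree_auto T" by (rule T.tree_auto_mult[OF a t])
    have fixes_others: "\<phi> g u = u" if "w \<in> level T j" "w \<noteq> v" "u \<in> desc T w" for w u
      using g that by (auto simp: vertex_subgroup_def stabilizer_def)
    have jump: "Orb T ?s j < Orb T ?s (Suc j)"
      by (rule T.Orb_jump_of_returning_child[OF t a v x fixes_others m g(2)])
    have "\<forall>w\<in>level T j. \<phi> g w = w"
      using T.fixes_parent[OF a] fixes_others T.child_exists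
      by (intro T.fixes_level_except_one[OF a v]) metis
    then have fixed: "\<phi> g w = w" if "w \<in> level T i" "i \<le> j" for i w
      using T.fixes_lower_levels[OF a] that by blast
    have same: "Orb T ?s i = Orb T t i" if "i \<le> j" for i
    proof (rule T.Orb_cong[OF s t])
      fix w assume w: "w \<in> level T i"
      then have "?s w = \<phi> g (t w)"
        using tree_auto_Bij[OF a] tree_auto_Bij[OF t] T.level_subset_verts
        by (simp add: BijGroup_mult_apply subset_iff)
      also have "\<dots> = t w" using fixed[OF _ that] w T.tree_auto_level[OF t] by blast
      finally show "?s w = t w" .
    qed
    have "\<not> P i ?s" if "i \<le> n" for i
      using same[of i] le_N[of i] that j unfolding P_def by simp
    moreover have "P (Suc j) ?s"
      using jump same[of j] N[of j] j unfolding P_def by simp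
    ultimately show "\<exists>g\<in>carrier G. (\<forall>i\<le>n. \<not> P i (\<phi> g \<otimes>\<^bsub>?B\<^esub> t)) \<and> (\<exists>i. P i (\<phi> g \<otimes>\<^bsub>?B\<^esub> t))"
      using gG by blast
  qed
qed

theorem theorem3p3:
  fixes T :: "'v rtree" and G :: "('g, 'm) monoid_scheme" and \<phi> :: "'g \<Rightarrow> 'v \<Rightarrow> 'v"
  assumes "spherically_symmetric_tree T"
    and "weakly_branch_group G T \<phi>"
    and "saturated G T \<phi>"
    and "weakly_stabilizer_transitive G T \<phi>"
    and "\<And>f. \<lbrakk>f \<in> auto G; \<not> inner_auto G f\<rbrakk> \<Longrightarrow>
      \<exists>t\<in>tree_auto T.
        (\<forall>g\<in>carrier G. \<phi> (f g) =
           t \<otimes>\<^bsub>BijGroup (verts T)\<^esub> \<phi> g \<otimes>\<^bsub>BijGroup (verts T)\<^esub> inv\<^bsub>BijGroup (verts T)\<^esub> t) \<and>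
        bdd_above (range (\<lambda>i. Orb T t i))"
  shows "R_infinity_group G"
proof -
  interpret weakly_branch_group G T \<phi> by fact
  have "group G" using group_hom by (rule group_hom.axioms(1))
  moreover have "reidemeister_number G f = \<infinity>" if "f \<in> auto G" for f
  proof (cases "inner_auto G f")
    case True
    then show ?thesis using reidemeister_inner assms(1) that by blast
  next
    case False
    then show ?thesis
      using assms(5)[OF that] reidemeister_bounded_orbits[OF assms(1,4) that] by blast
  qed
  ultimately show ?thesis by (simp add: R_infinity_group_def)
qed

end
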